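(* Let $s\ge 0$ be an integer and $n$ a positive integer, and let $t_m=\frac{m(m+1)}{2}$ denote the $m$-th triangular number. Define \[ \delta_s=\begin{cases}1,& \text{if } s\ge \lfloor\sqrt{s}\rfloor^2+\lfloor\sqrt{s}\rfloor,\\ 0,&\text{otherwise},\end{cases}\qquad q_s=2\lfloor\sqrt{s}\rfloor+2+\delta_s,\qquad c_s=s-\lfloor\sqrt{s}\rfloor^2-\delta_s\lfloor\sqrt{s}\rfloor . \] Then: (i) if $n$ is even and $n>6\lfloor\sqrt{s+1}\rfloor-6$, then \[ \mathtt{g}(t_n,t_{n+1},t_{n+2};s)=\frac{(n+1)(n+2)}{4}\,(q_s n+6c_s)-1; \] (ii) if $n$ is odd and $n>6\left\lfloor\frac{\sqrt{4s+5}-1}{2}\right\rfloor-3$, then \[ \mathtt{g}(t_n,t_{n+1},t_{n+2};s)=\frac{(n+1)(n+2)}{4}\,(q_s n+6c_s-3\delta_s)-1. \]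
   Context: For positive integers $a_1,\dots,a_k$ with $\gcd(a_1,\dots,a_k)=1$ and an integer $m\ge 0$, $\operatorname{d}(m;a_1,\dots,a_k)$ denotes the number of tuples $(x_1,\dots,x_k)$ of non-negative integers with $a_1x_1+\dots+a_kx_k=m$ (and is $0$ for negative $m$). For an integer $s\ge0$, the generalized Frobenius number is $\mathtt{g}(a_1,\dots,a_k;s)=\max\{m\in\mathbb{Z}:\operatorname{d}(m;a_1,\dots,a_k)\le s\}$, i.e. the largest integer having at most $s$ representations as a non-negative integer combination of $a_1,\dots,a_k$. *)

theory Defs
  imports Complex_Main "HOL-Library.Nat_Bijection"
begin

text \<open>
  Triangular numbers are \<^const>\<open>triangle\<close> from \<^theory>\<open>HOL-Library.Nat_Bijection\<close>:
  \<open>triangle n = n * Suc n div 2\<close>.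

  The tuple \<open>(a\<^sub>1, \<dots>, a\<^sub>k)\<close> is a list \<open>as\<close>, and a representation is a list \<open>xs\<close> of the same
  length. If all \<open>a\<^sub>i\<close> are positive, the set below is finite, so \<^const>\<open>card\<close> is the true count;
  it is empty for \<open>m < 0\<close>. If some \<open>a\<^sub>i\<close> is \<open>0\<close>, the value has no meaning.
\<close>

definition num_reps :: "int \<Rightarrow> nat list \<Rightarrow> nat" where
  "num_reps m as =
     card {xs :: nat list. length xs = length as \<and> int (\<Sum>i<length as. as ! i * xs ! i) = m}"

text \<open>
  The maximum ranges over a set of integers that contains all negative ones, so \<^const>\<open>Max\<close>, which
  is meant for finite sets, does not apply. \<^const>\<open>Greatest\<close> is the maximum whenever one exists, in
  particular when all \<open>a\<^sub>i\<close> are positive with greatest common divisor \<open>1\<close>. This holds for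
  three consecutive triangular numbers \<open>t\<^sub>n\<close>, \<open>t\<^bsub>n+1\<^esub>\<close>, \<open>t\<^bsub>n+2\<^esub>\<close> with \<open>n > 0\<close>.
\<close>

definition gen_frobenius :: "nat list \<Rightarrow> nat \<Rightarrow> int" where
  "gen_frobenius as s = (GREATEST m :: int. num_reps m as \<le> s)"

definition delta :: "nat \<Rightarrow> int" where
  "delta s = (if int s \<ge> \<lfloor>sqrt (real s)\<rfloor>^2 + \<lfloor>sqrt (real s)\<rfloor> then 1 else 0)"

definition q_coeff :: "nat \<Rightarrow> int" where
  "q_coeff s = 2 * \<lfloor>sqrt (real s)\<rfloor> + 2 + delta s"

definition c_coeff :: "nat \<Rightarrow> int" where
  "c_coeff s = int s - \<lfloor>sqrt (real s)\<rfloor>^2 - delta s * \<lfloor>sqrt (real s)\<rfloor>"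

end

theory Submission
  imports Defs "HOL-Number_Theory.Cong"
begin

text \<open>
  The three triangular numbers have the form \<open>a * Q\<close>, \<open>P * Q\<close>, \<open>c * P\<close> with \<open>P\<close>, \<open>Q\<close> coprime,
  \<open>a\<close> coprime to \<open>P\<close> and \<open>c\<close> coprime to \<open>Q\<close>. In a representation of \<open>m\<close> the first coefficient is
  then determined modulo \<open>P\<close> and the third modulo \<open>Q\<close>, so that the representations correspond to
  the lattice points \<open>(i, j)\<close> of a triangle \<open>a * i + c * j \<le> M\<close>. The Frobenius number is
  therefore governed by the \<open>s\<close>-th smallest weight \<open>a * i + c * j\<close>, counted from \<open>0\<close>. One of \<open>a\<close>,
  \<open>c\<close> is nearly twice the other, the defect being \<open>3\<close>; as long as \<open>s\<close> is small compared with \<open>n\<close>,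
  the weights are ordered first by \<open>r = i + 2 * j\<close> (or \<open>2 * i + j\<close>) and then within each of these
  blocks, whose sizes are \<open>1, 1, 2, 2, 3, 3, \<dots>\<close>.
\<close>

section \<open>Representations as lattice points\<close>

text \<open>The bound \<open>M\<close> is an integer because it may be negative once the least
  residues are subtracted from the target; the triangle is then empty, as is the set of
  representations.\<close>

definition lattice_triangle :: "nat \<Rightarrow> nat \<Rightarrow> int \<Rightarrow> (nat \<times> nat) set" where
  "lattice_triangle a c M = {(i, j). int (a * i + c * j) \<le> M}"

lemma finite_lattice_triangle:
  assumes "a > 0" "c > 0"
  shows "finite (lattice_triangle a c M)"
proof (rule finite_subset)
  show "lattice_triangle a c M \<subseteq> {..nat M} \<times> {..nat M}"
  proof clarify
    fix i j assume "(i, j) \<in> lattice_triangle a c M"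
    then have "int (a * i + c * j) \<le> M" by (simp add: lattice_triangle_def)
    then have "a * i + c * j \<le> nat M" by (metis nat_int nat_mono)
    moreover have "i \<le> a * i" "j \<le> c * j" using assms by auto
    ultimately have "i \<le> nat M" "j \<le> nat M" by linarith+
    then show "i \<in> {..nat M} \<and> j \<in> {..nat M}" by simp
  qed
qed simp

lemma int_dvd_diff_imp_split:
  fixes x x0 P :: nat
  assumes "int P dvd int x - int x0" "x0 < P"
  obtains i where "x = x0 + P * i"
proof -
  have "x mod P = x0"
    using assms by (metis mod_eq_dvd_iff mod_less of_nat_eq_iff zmod_int)
  then have "x = x0 + P * (x div P)" by (metis mod_mult_div_eq)
  then show ?thesis by (rule that)
qed

text \<open>Modulo \<open>P\<close> only the first term survives and \<open>a * Q\<close> is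
  invertible, so the first coefficient is \<open>x0 + P * i\<close>, with \<open>i\<close>
  non-negative because \<open>x0 < P\<close>. Likewise the third is \<open>z0 + Q * j\<close>.
  Cancelling \<open>P * Q\<close> leaves \<open>M - (a * i + c * j)\<close> for the middle
  coefficient, and its sign is the only remaining condition.\<close>

lemma num_reps_eq_card_lattice_triangle:
  fixes a c P Q x0 z0 :: nat and M :: int
  assumes co: "coprime P Q" "coprime a P" "coprime c Q"
    and lt: "x0 < P" "z0 < Q"
  shows "num_reps (int (a * Q * x0) + int (c * P * z0) + int (P * Q) * M) [a * Q, P * Q, c * P]
       = card (lattice_triangle a c M)"
proof -
  let ?m = "int (a * Q * x0) + int (c * P * z0) + int (P * Q) * M"
  let ?R = "{xs :: nat list. length xs = length [a * Q, P * Q, c * P] \<and>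
      int (\<Sum>i<length [a * Q, P * Q, c * P]. [a * Q, P * Q, c * P] ! i * xs ! i) = ?m}"
  \<comment> \<open>On the triangle the difference is non-negative, so \<open>nat\<close> truncates
    nothing there.\<close>
  define g :: "nat \<times> nat \<Rightarrow> nat list" where
    "g = (\<lambda>(i, j). [x0 + P * i, nat (M - int (a * i + c * j)), z0 + Q * j])"
  have pos: "P > 0" "Q > 0" using lt by auto
  have sum3: "(\<Sum>i<length [a * Q, P * Q, c * P]. [a * Q, P * Q, c * P] ! i * [x, y, z] ! i)
      = a * Q * x + P * Q * y + c * P * z" for x y z :: nat
    by (simp add: numeral_3_eq_3)
  have "?R = g ` lattice_triangle a c M"
  proof (intro equalityI subsetI)
    fix xs assume xs: "xs \<in> ?R"
    then obtain x y z where xyz: "xs = [x, y, z]"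
      by (auto simp: numeral_3_eq_3 length_Suc_conv)
    have eq: "int (a * Q * x) + int (P * Q * y) + int (c * P * z) = ?m"
      using xs unfolding xyz by (simp add: numeral_3_eq_3)
    have "int a * int Q * (int x - int x0)
        = int P * (int c * int z0 + int Q * M - int Q * int y - int c * int z)"
      using eq by (simp add: algebra_simps)
    then have "int P dvd int a * int Q * (int x - int x0)" by simp
    moreover have "coprime (int P) (int a * int Q)"
      using co by (simp add: coprime_commute)
    ultimately have "int P dvd int x - int x0" by (simp add: coprime_dvd_mult_right_iff)
    then obtain i where i: "x = x0 + P * i" using lt(1) by (rule int_dvd_diff_imp_split)
    have "int c * int P * (int z - int z0)
        = int Q * (int a * int x0 + int P * M - int P * int y - int a * int x)"
      using eq by (simp add: algebra_simps)
    then have "int Q dvd int c * int P * (int z - int z0)" by simp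
    moreover have "coprime (int Q) (int c * int P)"
      using co by (simp add: coprime_commute)
    ultimately have "int Q dvd int z - int z0" by (simp add: coprime_dvd_mult_right_iff)
    then obtain j where j: "z = z0 + Q * j" using lt(2) by (rule int_dvd_diff_imp_split)
    have "int (P * Q) * (int y + int (a * i + c * j)) = int (P * Q) * M"
      using eq unfolding i j by (simp add: algebra_simps)
    then have M: "int y + int (a * i + c * j) = M" using pos by simp
    then have "(i, j) \<in> lattice_triangle a c M" by (simp add: lattice_triangle_def)
    moreover have "g (i, j) = xs" using M by (simp add: g_def xyz i j)
    ultimately show "xs \<in> g ` lattice_triangle a c M" by (metis imageI)
  next
    fix xs assume "xs \<in> g ` lattice_triangle a c M"
    then obtain i j where le: "int (a * i + c * j) \<le> M" and xs: "xs = g (i, j)"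
      by (auto simp: lattice_triangle_def)
    obtain y where y: "M = int y + int (a * i + c * j)"
      using le by (metis zle_iff_zadd add.commute)
    have xs': "xs = [x0 + P * i, y, z0 + Q * j]" by (simp add: xs g_def y)
    have "int (a * Q * (x0 + P * i) + P * Q * y + c * P * (z0 + Q * j)) = ?m"
      unfolding y by (simp add: algebra_simps)
    then show "xs \<in> ?R" unfolding xs' mem_Collect_eq sum3 by simp
  qed
  moreover have "inj_on g (lattice_triangle a c M)"
    using pos by (auto simp: inj_on_def g_def)
  ultimately show ?thesis
    unfolding num_reps_def by (simp add: card_image)
qed

text \<open>Chinese remaindering: \<open>x0\<close> solves the congruence modulo \<open>P\<close>
  and \<open>z0\<close> the one modulo \<open>Q\<close>; the remainder of \<open>m\<close> is then
  divisible by both moduli, hence by their product.\<close>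

lemma residue_decomposition:
  fixes a c P Q :: nat and m :: int
  assumes co: "coprime P Q" "coprime a P" "coprime c Q" and pos: "P > 0" "Q > 0"
  obtains x0 z0 M where "x0 < P" "z0 < Q"
    "m = int (a * Q * x0) + int (c * P * z0) + int (P * Q) * M"
proof -
  have residue: "\<exists>x<p. int p dvd m - int b * int x" if "coprime b p" "p > 0" for b p :: nat
  proof -
    have "\<exists>y. [int b * y = 1] (mod int p)"
      using that cong_solve_coprime_int[of "int b" "int p"] by simp
    then obtain y where "[int b * y = 1] (mod int p)" ..
    then have "[int b * (y * m) = m] (mod int p)"
      by (metis cong_scalar_right mult.assoc mult_1)
    moreover have "[int b * (y * m mod int p) = int b * (y * m)] (mod int p)"
      by (simp add: cong_def mod_mult_right_eq)
    ultimately have "[m = int b * (y * m mod int p)] (mod int p)"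
      by (metis cong_sym cong_trans)
    moreover have "int (nat (y * m mod int p)) = y * m mod int p" "nat (y * m mod int p) < p"
      using that by (simp_all add: nat_less_iff)
    ultimately show ?thesis by (metis cong_iff_dvd_diff)
  qed
  obtain x0 where x0: "x0 < P" "int P dvd m - int (a * Q) * int x0"
    using residue[of "a * Q" P] co pos by (auto simp: coprime_commute)
  obtain z0 where z0: "z0 < Q" "int Q dvd m - int (c * P) * int z0"
    using residue[of "c * P" Q] co pos by (auto simp: coprime_commute)
  let ?d = "m - int (a * Q * x0) - int (c * P * z0)"
  have "?d = (m - int (a * Q) * int x0) - int P * int (c * z0)" by (simp add: algebra_simps)
  then have "int P dvd ?d" using x0(2) by (metis dvd_diff dvd_triv_left)
  moreover have "?d = (m - int (c * P) * int z0) - int Q * int (a * x0)"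
    by (simp add: algebra_simps)
  then have "int Q dvd ?d" using z0(2) by (metis dvd_diff dvd_triv_left)
  ultimately have "int P * int Q dvd ?d" using co(1) by (simp add: divides_mult)
  then obtain M where "?d = int P * int Q * M" by (rule dvdE)
  then have "m = int (a * Q * x0) + int (c * P * z0) + int (P * Q) * M" by simp
  with x0(1) z0(1) show ?thesis by (rule that)
qed

text \<open>\<open>S\<close> collects \<open>s\<close> points of least weight and
  \<open>(i0, j0)\<close> is a next one, of weight \<open>L\<close>; ties are allowed. At most
  \<open>s\<close> representations then means exactly a bound \<open>M\<close> of at most
  \<open>L - 1\<close>, and the value is largest for the largest residues.\<close>

lemma gen_frobenius_eqI:
  fixes a c P Q s :: nat and L :: nat
  assumes co: "coprime P Q" "coprime a P" "coprime c Q"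
    and pos: "P > 0" "Q > 0" "a > 0" "c > 0"
    and L: "a * i0 + c * j0 = L"
    and S: "finite S" "card S = s" "(i0, j0) \<notin> S"
    and below: "\<And>i j. (i, j) \<in> S \<Longrightarrow> a * i + c * j \<le> L"
    and above: "\<And>i j. (i, j) \<notin> S \<Longrightarrow> L \<le> a * i + c * j"
  shows "gen_frobenius [a * Q, P * Q, c * P] s
       = int (a * Q) * (int P - 1) + int (c * P) * (int Q - 1) + int (P * Q) * (int L - 1)"
    (is "_ = ?m")
  unfolding gen_frobenius_def
proof (rule Greatest_equality)
  have "lattice_triangle a c (int L - 1) \<subseteq> S"
  proof clarify
    fix i j assume "(i, j) \<in> lattice_triangle a c (int L - 1)"
    then have "int (a * i + c * j) < int L" by (simp add: lattice_triangle_def)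
    then have "a * i + c * j < L" by (simp only: of_nat_less_iff)
    then show "(i, j) \<in> S" using above by (meson leD)
  qed
  then have "card (lattice_triangle a c (int L - 1)) \<le> s"
    using S by (metis card_mono)
  \<comment> \<open>The candidate is the normal form with residues \<open>P - 1\<close>,
    \<open>Q - 1\<close> and bound \<open>L - 1\<close>.\<close>
  moreover have "?m = int (a * Q * (P - 1)) + int (c * P * (Q - 1)) + int (P * Q) * (int L - 1)"
    using pos by (simp add: of_nat_diff Suc_leI)
  ultimately show "num_reps ?m [a * Q, P * Q, c * P] \<le> s"
    using num_reps_eq_card_lattice_triangle[OF co, of "P - 1" "Q - 1" "int L - 1"] pos
    by simp
next
  fix m assume m: "num_reps m [a * Q, P * Q, c * P] \<le> s"
  obtain x0 z0 M where lt: "x0 < P" "z0 < Q"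
    and m_eq: "m = int (a * Q * x0) + int (c * P * z0) + int (P * Q) * M"
    by (rule residue_decomposition[OF co pos(1,2)])
  have card_le: "card (lattice_triangle a c M) \<le> s"
    using m num_reps_eq_card_lattice_triangle[OF co lt] m_eq by simp
  have "M < int L"
  proof (rule ccontr)
    assume "\<not> M < int L"
    then have le: "int L \<le> M" by simp
    \<comment> \<open>A bound of at least \<open>L\<close> would admit \<open>s + 1\<close>
      points.\<close>
    have "insert (i0, j0) S \<subseteq> lattice_triangle a c M"
    proof clarify
      fix i j assume "(i, j) \<in> insert (i0, j0) S"
      then have "a * i + c * j \<le> L" using below L by auto
      then have "int (a * i + c * j) \<le> int L" by (simp only: of_nat_le_iff)
      then show "(i, j) \<in> lattice_triangle a c M"
        using le by (simp add: lattice_triangle_def)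
    qed
    then have "card (insert (i0, j0) S) \<le> card (lattice_triangle a c M)"
      using finite_lattice_triangle pos by (metis card_mono)
    then show False using S card_le by simp
  qed
  then have "int (P * Q) * M \<le> int (P * Q) * (int L - 1)"
    by (intro mult_left_mono) auto
  moreover have "int (a * Q) * int x0 \<le> int (a * Q) * (int P - 1)"
    "int (c * P) * int z0 \<le> int (c * P) * (int Q - 1)"
    using lt by (intro mult_left_mono; simp)+
  ultimately show "m \<le> ?m" unfolding m_eq of_nat_mult by linarith
qed

section \<open>The block structure of the weights\<close>

definition block :: "nat \<Rightarrow> (nat \<times> nat) set" where
  "block r = {(i, j). i + 2 * j = r}"

definition blocks_below :: "nat \<Rightarrow> (nat \<times> nat) set" where
  "blocks_below r = {(i, j). i + 2 * j < r}"

lemma block_eq: "block r = (\<lambda>j. (r - 2 * j, j)) ` {..r div 2}"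
  by (auto simp: block_def image_iff)

text \<open>Partial sums of the block sizes 1, 1, 2, 2, 3, 3, ...: the quarter-squares.\<close>

lemma finite_card_blocks_below:
  "finite (blocks_below r) \<and> card (blocks_below r) = ((r + 1) div 2) * ((r + 2) div 2)"
proof (induction r)
  case 0
  then show ?case by (simp add: blocks_below_def)
next
  case (Suc r)
  have split: "blocks_below (Suc r) = blocks_below r \<union> block r"
    by (auto simp: blocks_below_def block_def)
  have disj: "blocks_below r \<inter> block r = {}"
    by (auto simp: blocks_below_def block_def)
  have "inj_on (\<lambda>j. (r - 2 * j, j)) {..r div 2}" by (auto simp: inj_on_def)
  then have "card (block r) = r div 2 + 1" "finite (block r)"
    by (simp_all add: block_eq card_image)
  then have "finite (blocks_below (Suc r))"
    "card (blocks_below (Suc r)) = ((r + 1) div 2) * ((r + 2) div 2) + (r div 2 + 1)"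
    using Suc disj by (simp_all add: split card_Un_disjoint)
  \<comment> \<open>One factor, \<open>(r + 2) div 2 = r div 2 + 1\<close>, is shared, while the
    other grows by one.\<close>
  moreover have "((r + 1) div 2) * ((r + 2) div 2) + (r div 2 + 1)
      = ((Suc r + 1) div 2) * ((Suc r + 2) div 2)"
    by (simp add: algebra_simps)
  ultimately show ?case by simp
qed

text \<open>The part \<open>J\<close> of the last block is left arbitrary: for even \<open>n\<close>
  the weights in a block increase with \<open>j\<close>, for odd \<open>n\<close> they decrease, so
  opposite ends are needed.\<close>

lemma finite_card_initial_segment:
  assumes J: "J \<subseteq> {..r div 2}"
    and s: "s = ((r + 1) div 2) * ((r + 2) div 2) + card J"
  shows "finite (blocks_below r \<union> {(i, j) \<in> block r. j \<in> J})"
    and "card (blocks_below r \<union> {(i, j) \<in> block r. j \<in> J}) = s"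
proof -
  have eq: "{(i, j) \<in> block r. j \<in> J} = (\<lambda>j. (r - 2 * j, j)) ` J"
    using J by (auto simp: block_def image_iff)
  have fin: "finite J" using J finite_subset by blast
  have "inj_on (\<lambda>j. (r - 2 * j, j)) J" by (auto simp: inj_on_def)
  then have "card {(i, j) \<in> block r. j \<in> J} = card J" by (simp add: eq card_image)
  moreover have "finite {(i, j) \<in> block r. j \<in> J}" using fin by (simp add: eq)
  moreover have "blocks_below r \<inter> {(i, j) \<in> block r. j \<in> J} = {}"
    by (auto simp: blocks_below_def block_def)
  ultimately show "finite (blocks_below r \<union> {(i, j) \<in> block r. j \<in> J})"
    "card (blocks_below r \<union> {(i, j) \<in> block r. j \<in> J}) = s"
    using finite_card_blocks_below[of r] s by (simp_all add: card_Un_disjoint)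
qed

text \<open>With \<open>u\<close> the integer square root of \<open>s\<close>, block
  \<open>2 * u - 1\<close> starts at position \<open>u^2\<close> (for \<open>u > 0\<close>) and
  block \<open>2 * u\<close> at \<open>u^2 + u\<close>. Hence \<open>delta s\<close> tells which of
  the two contains position \<open>s\<close>, and \<open>c_coeff s\<close> is the offset inside
  it.\<close>

lemma obtain_block_position:
  obtains r c where "c \<le> r div 2" "s = ((r + 1) div 2) * ((r + 2) div 2) + c"
    "q_coeff s = int r + 3" "c_coeff s = int c" "delta s = (if even r then 1 else 0)"
proof -
  define u where "u = nat \<lfloor>sqrt (real s)\<rfloor>"
  have u: "\<lfloor>sqrt (real s)\<rfloor> = int u" by (simp add: u_def)
  then have "real u \<le> sqrt (real s)" "sqrt (real s) < real u + 1"
    by (simp_all add: floor_eq_iff)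
  then have "(real u)\<^sup>2 \<le> (sqrt (real s))\<^sup>2" "(sqrt (real s))\<^sup>2 < (real u + 1)\<^sup>2"
    by (intro power_mono power_strict_mono; simp)+
  then have "real (u\<^sup>2) \<le> real s" "real s < real ((u + 1)\<^sup>2)"
    by (simp_all add: add.commute)
  then have bounds: "u\<^sup>2 \<le> s" "s < (u + 1)\<^sup>2" by (simp_all only: of_nat_le_iff of_nat_less_iff)
  have delta: "delta s = (if u\<^sup>2 + u \<le> s then 1 else 0)"
    unfolding delta_def u by (metis of_nat_add of_nat_le_iff of_nat_power)
  show ?thesis
  proof (cases "u\<^sup>2 + u \<le> s")
    case True
    show ?thesis
    proof (rule that[of "s - u\<^sup>2 - u" "2 * u"])
      show "s - u\<^sup>2 - u \<le> 2 * u div 2"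
        using bounds by (simp add: power2_eq_square)
      show "c_coeff s = int (s - u\<^sup>2 - u)"
        using True by (simp add: c_coeff_def u delta of_nat_diff)
    qed (use True in \<open>simp_all add: q_coeff_def u delta power2_eq_square\<close>)
  next
    case False
    \<comment> \<open>Here \<open>u\<close> is nonzero, so the block index \<open>2 * u - 1\<close>
      can be written \<open>2 * v + 1\<close>.\<close>
    then obtain v where v: "u = Suc v" using bounds by (cases u) auto
    show ?thesis
    proof (rule that[of "s - u\<^sup>2" "2 * v + 1"])
      show "s - u\<^sup>2 \<le> (2 * v + 1) div 2"
        using False v by simp
      show "c_coeff s = int (s - u\<^sup>2)"
        using False bounds by (simp add: c_coeff_def u delta of_nat_diff)
      show "s = (2 * v + 1 + 1) div 2 * ((2 * v + 1 + 2) div 2) + (s - u\<^sup>2)"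
        using bounds by (simp add: v power2_eq_square)
    qed (use False in \<open>simp_all add: q_coeff_def u delta v\<close>)
  qed
qed

section \<open>The two parities\<close>

lemma coprime_nat_if_mult_eq_Suc:
  fixes a b x y :: nat
  assumes "a * x = b * y + 1"
  shows "coprime a b"
proof (rule coprimeI)
  fix d assume "d dvd a" "d dvd b"
  then have "d dvd b * y + 1" "d dvd b * y" using assms by (metis dvd_mult2)+
  then show "is_unit d" by (metis dvd_add_right_iff)
qed

lemma triangle_eqI: "n * (n + 1) = 2 * m \<Longrightarrow> triangle n = m"
  by (simp add: triangle_def)

text \<open>The weight is \<open>k * (i + 2 * j) + 3 * j\<close>, so the \<open>c\<close> lightest
  points of block \<open>r\<close> are those with \<open>j < c\<close>. The hypothesis
  \<open>small\<close> bounds the terms \<open>3 * j\<close> so that neighbouring blocks at most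
  touch at the weights that matter.\<close>

lemma gen_frobenius_triangle_even:
  assumes k: "k > 0"
    and c: "c \<le> r div 2" and s: "s = ((r + 1) div 2) * ((r + 2) div 2) + c"
    and small: "\<And>v. v\<^sup>2 \<le> s + 1 \<Longrightarrow> 3 * v \<le> k + 3"
  shows "gen_frobenius [triangle (2 * k), triangle (2 * k + 1), triangle (2 * k + 2)] s
       = int (k + 1) * int (2 * k + 1) * (int k * (int r + 3) + 3 * int c) - 1"
proof -
  have "(c + 1)\<^sup>2 \<le> s + 1"
  proof -
    \<comment> \<open>Adding \<open>c + 1\<close> to the left side completes the square.\<close>
    have "c * (c + 1) \<le> ((r + 1) div 2) * ((r + 2) div 2)"
      using c by (intro mult_le_mono) auto
    then show ?thesis using s by (simp add: power2_eq_square)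
  qed
  from small[OF this] have kc: "3 * c \<le> k" by simp
  have "((r + 1) div 2)\<^sup>2 \<le> s + 1"
  proof -
    have "((r + 1) div 2)\<^sup>2 \<le> ((r + 1) div 2) * ((r + 2) div 2)"
      unfolding power2_eq_square by (intro mult_le_mono) auto
    then show ?thesis using s by simp
  qed
  from small[OF this] have kr: "3 * ((r + 1) div 2) \<le> k + 3" .
  have weight: "k * i + (2 * k + 3) * j = k * (i + 2 * j) + 3 * j" for i j
    by (simp add: algebra_simps)
  let ?L = "k * r + 3 * c"
  let ?S = "blocks_below r \<union> {(i, j) \<in> block r. j \<in> {..<c}}"
  have frob: "gen_frobenius [k * (2 * k + 1), (k + 1) * (2 * k + 1), (2 * k + 3) * (k + 1)] s
      = int (k * (2 * k + 1)) * (int (k + 1) - 1) + int ((2 * k + 3) * (k + 1)) * (int (2 * k + 1) - 1)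
        + int ((k + 1) * (2 * k + 1)) * (int ?L - 1)"
  proof (rule gen_frobenius_eqI[where ?i0.0 = "r - 2 * c" and ?j0.0 = c and S = ?S])
    show "coprime (k + 1) (2 * k + 1)"
      by (rule coprime_nat_if_mult_eq_Suc[of _ 2 _ 1]) simp
    show "coprime k (k + 1)"
      by (subst coprime_commute, rule coprime_nat_if_mult_eq_Suc[of _ 1 _ 1]) simp
    show "coprime (2 * k + 3) (2 * k + 1)"
      by (rule coprime_nat_if_mult_eq_Suc[of _ "k + 1" _ "k + 2"]) (simp add: algebra_simps)
    show "k * (r - 2 * c) + (2 * k + 3) * c = ?L"
      using c by (simp add: weight)
    have "{..<c} \<subseteq> {..r div 2}" "s = ((r + 1) div 2) * ((r + 2) div 2) + card {..<c}"
      using c s by auto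
    then show "finite ?S" "card ?S = s" by (rule finite_card_initial_segment)+
    show "(r - 2 * c, c) \<notin> ?S"
      using c by (auto simp: blocks_below_def)
    show "k * i + (2 * k + 3) * j \<le> ?L" if "(i, j) \<in> ?S" for i j
    proof (cases "i + 2 * j < r")
      case True
      then have "k * (i + 2 * j + 1) \<le> k * r" by (intro mult_le_mono) auto
      \<comment> \<open>The increment \<open>3 * j\<close> in an earlier block is at most
        \<open>k\<close>, the gap between consecutive block bases.\<close>
      moreover have "j + 1 \<le> (r + 1) div 2" using True by linarith
      then have "3 * j \<le> k" using kr by linarith
      ultimately show ?thesis by (simp add: weight algebra_simps)
    next
      case False
      then show ?thesis using that by (auto simp: weight blocks_below_def block_def)
    qed
    show "?L \<le> k * i + (2 * k + 3) * j" if "(i, j) \<notin> ?S" for i j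
    proof (cases "i + 2 * j = r")
      case True
      then have "k * (i + 2 * j) = k * r" by simp
      moreover have "c \<le> j" using that True by (auto simp: block_def)
      ultimately show ?thesis unfolding weight by linarith
    next
      case False
      then have "k * (r + 1) \<le> k * (i + 2 * j)"
        using that by (intro mult_le_mono) (auto simp: blocks_below_def)
      then show ?thesis using kc by (simp add: weight algebra_simps)
    qed
  qed (use k in auto)
  have triangles: "triangle (2 * k) = k * (2 * k + 1)"
    "triangle (2 * k + 1) = (k + 1) * (2 * k + 1)"
    "triangle (2 * k + 2) = (2 * k + 3) * (k + 1)"
    by (rule triangle_eqI; simp add: algebra_simps)+
  show ?thesis unfolding triangles frob by (simp add: algebra_simps)
qed

text \<open>Now the heavier weight belongs to the first coordinate, so points are swapped before
  blocks are formed. The weight \<open>(k + 2) * (i + 2 * j) - 3 * j\<close> decreases with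
  \<open>j\<close> in a block, so the lightest points have the largest \<open>j\<close>.\<close>

lemma gen_frobenius_triangle_odd:
  assumes c: "c \<le> r div 2" and s: "s = ((r + 1) div 2) * ((r + 2) div 2) + c"
    and small: "\<And>w. w * (w + 1) \<le> s + 1 \<Longrightarrow> 3 * w \<le> k + 1"
  shows "gen_frobenius [triangle (2 * k + 1), triangle (2 * k + 2), triangle (2 * k + 3)] s
       = int (k + 1) * int (2 * k + 3) * ((int k + 2) * int r - 3 * int (r div 2) + 3 * int c + 3 * int k) - 1"
proof -
  \<comment> \<open>Counting \<open>c\<close> places down from the top value \<open>r div 2\<close>
    gives the \<open>j\<close> of the point of weight \<open>L\<close>.\<close>
  define h where "h = r div 2 - c"
  have "(r div 2) * (r div 2 + 1) \<le> ((r + 1) div 2) * ((r + 2) div 2)"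
    by (intro mult_le_mono) auto
  then have kr: "3 * (r div 2) \<le> k + 1" using s by (intro small) simp
  \<comment> \<open>This difference compares the least weight of block \<open>r + 1\<close> with the
    weight at \<open>j = h\<close> in block \<open>r\<close>.\<close>
  have "((r + 1) div 2 - h) * ((r + 1) div 2 - h + 1) \<le> s + 1"
  proof (cases "even r \<or> 0 < h")
    case True
    then have "(r + 1) div 2 - h \<le> r div 2" by (auto elim: oddE)
    then have "((r + 1) div 2 - h) * ((r + 1) div 2 - h + 1) \<le> ((r + 1) div 2) * ((r + 2) div 2)"
      by (intro mult_le_mono) auto
    then show ?thesis using s by simp
  next
    case False
    \<comment> \<open>The extremal case: \<open>s\<close> is the last position of an odd block and
      equality holds, both sides being \<open>(b + 1) * (b + 2)\<close>.\<close>
    then obtain b where "r = 2 * b + 1" by (auto elim: oddE)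
    then show ?thesis using False c s by (simp add: h_def)
  qed
  from small[OF this] have kh: "3 * ((r + 1) div 2) \<le> k + 1 + 3 * h" by simp
  have weight: "int ((2 * k + 1) * j + (k + 2) * i) = (int k + 2) * int (i + 2 * j) - 3 * int j"
    for i j by (simp add: algebra_simps)
  let ?L = "(2 * k + 1) * h + (k + 2) * (r - 2 * h)"
  let ?T = "blocks_below r \<union> {(i, j) \<in> block r. j \<in> {h<..r div 2}}"
  let ?S = "prod.swap ` ?T"
  have hr: "2 * h \<le> r" unfolding h_def by simp
  have L: "int ?L = (int k + 2) * int r - 3 * int h"
    unfolding weight using hr by simp
  have mem: "(j, i) \<in> ?S \<longleftrightarrow> (i, j) \<in> ?T" for i j
    using inj_image_mem_iff[OF inj_swap, of "(i, j)" ?T] by (simp only: swap_simp)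
  have frob: "gen_frobenius [(2 * k + 1) * (k + 1), (2 * k + 3) * (k + 1), (k + 2) * (2 * k + 3)] s
      = int ((2 * k + 1) * (k + 1)) * (int (2 * k + 3) - 1)
        + int ((k + 2) * (2 * k + 3)) * (int (k + 1) - 1)
        + int ((2 * k + 3) * (k + 1)) * (int ?L - 1)"
  proof (rule gen_frobenius_eqI[where ?i0.0 = h and ?j0.0 = "r - 2 * h" and S = ?S])
    show "coprime (2 * k + 3) (k + 1)"
      by (rule coprime_nat_if_mult_eq_Suc[of _ 1 _ 2]) simp
    show "coprime (2 * k + 1) (2 * k + 3)"
      by (subst coprime_commute, rule coprime_nat_if_mult_eq_Suc[of _ "k + 1" _ "k + 2"])
        (simp add: algebra_simps)
    show "coprime (k + 2) (k + 1)"
      by (rule coprime_nat_if_mult_eq_Suc[of _ 1 _ 1]) simp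
    have "{h<..r div 2} \<subseteq> {..r div 2}"
      "s = ((r + 1) div 2) * ((r + 2) div 2) + card {h<..r div 2}"
      using c s by (auto simp: h_def)
    then have "finite ?T" "card ?T = s" by (rule finite_card_initial_segment)+
    then show "finite ?S" "card ?S = s"
      by (auto simp: card_image)
    show "(h, r - 2 * h) \<notin> ?S"
      unfolding mem using hr by (auto simp: blocks_below_def)
    show "(2 * k + 1) * j + (k + 2) * i \<le> ?L" if "(j, i) \<in> ?S" for j i
    proof -
      have "(int k + 2) * int (i + 2 * j) - 3 * int j \<le> (int k + 2) * int r - 3 * int h"
      proof (cases "i + 2 * j < r")
        case True
        then have "(int k + 2) * (int (i + 2 * j) + 1) \<le> (int k + 2) * int r"
          by (intro mult_left_mono) auto
        moreover have "3 * h \<le> k + 1" using kr unfolding h_def by linarith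
        ultimately show ?thesis by (simp add: distrib_left)
      next
        case False
        then have "i + 2 * j = r" "h < j"
          using that unfolding mem by (auto simp: blocks_below_def block_def)
        then show ?thesis by simp
      qed
      then show ?thesis unfolding weight[symmetric] L[symmetric] by (simp only: of_nat_le_iff)
    qed
    show "?L \<le> (2 * k + 1) * j + (k + 2) * i" if "(j, i) \<notin> ?S" for j i
    proof -
      have "(int k + 2) * int r - 3 * int h \<le> (int k + 2) * int (i + 2 * j) - 3 * int j"
      proof (cases "i + 2 * j = r")
        case True
        then have "j \<le> h" using that unfolding mem by (auto simp: block_def)
        then show ?thesis using True by simp
      next
        case False
        then have "r + 1 \<le> i + 2 * j"
          using that unfolding mem by (auto simp: blocks_below_def)
        then obtain e where e: "i + 2 * j = r + 1 + e" using le_Suc_ex by blast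
        show ?thesis
        \<comment> \<open>Each further block adds \<open>k + 2\<close> and may lose 3 through
          \<open>j\<close>, which is harmless only for \<open>k > 0\<close>. For
          \<open>k = 0\<close> the bounds force \<open>r = 0\<close> and \<open>h = 0\<close>, so
          \<open>L\<close> is zero.\<close>
        proof (cases "k = 0")
          case True
          then have "r div 2 = 0" using kr by linarith
          then have h0: "h = 0" by (simp add: h_def)
          then have "r = 0" using kh True by linarith
          then show ?thesis using True h0 by simp
        next
          case False
          then have "3 * int e \<le> (int k + 2) * int e" by (intro mult_right_mono) auto
          moreover have "j \<le> (r + 1) div 2 + e" using e by linarith
          then have "3 * int j \<le> int k + 1 + 3 * int h + 3 * int e" using kh by linarith
          ultimately show ?thesis unfolding e by (simp add: distrib_left)
        qed
      qed
      then show ?thesis unfolding weight[symmetric] L[symmetric] by (simp only: of_nat_le_iff)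
    qed
  qed auto
  have triangles: "triangle (2 * k + 1) = (2 * k + 1) * (k + 1)"
    "triangle (2 * k + 2) = (2 * k + 3) * (k + 1)"
    "triangle (2 * k + 3) = (k + 2) * (2 * k + 3)"
    by (rule triangle_eqI; simp add: algebra_simps)+
  have half: "int (r div 2) = int h + int c" using c by (simp add: h_def)
  show ?thesis unfolding triangles frob L half by (simp add: algebra_simps)
qed

section \<open>From the square root bounds to integer inequalities\<close>

theorem theorem1p1:
  fixes s n :: nat
  assumes "n > 0"
  shows "(even n \<and> int n > 6 * \<lfloor>sqrt (real s + 1)\<rfloor> - 6 \<longrightarrow>
           real_of_int (gen_frobenius [triangle n, triangle (n + 1), triangle (n + 2)] s) =
             (real n + 1) * (real n + 2) / 4
               * (of_int (q_coeff s) * real n + 6 * of_int (c_coeff s)) - 1)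
       \<and> (odd n \<and> int n > 6 * \<lfloor>(sqrt (4 * real s + 5) - 1) / 2\<rfloor> - 3 \<longrightarrow>
           real_of_int (gen_frobenius [triangle n, triangle (n + 1), triangle (n + 2)] s) =
             (real n + 1) * (real n + 2) / 4
               * (of_int (q_coeff s) * real n + 6 * of_int (c_coeff s) - 3 * of_int (delta s)) - 1)"
proof -
  obtain r c where c: "c \<le> r div 2" and s: "s = ((r + 1) div 2) * ((r + 2) div 2) + c"
    and coeffs: "q_coeff s = int r + 3" "c_coeff s = int c" "delta s = (if even r then 1 else 0)"
    by (rule obtain_block_position)
  show ?thesis
  proof (intro conjI impI; elim conjE)
    assume "even n" and n: "int n > 6 * \<lfloor>sqrt (real s + 1)\<rfloor> - 6"
    then obtain k where k: "n = 2 * k" by blast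
    have small: "3 * v \<le> k + 3" if "v\<^sup>2 \<le> s + 1" for v
    proof -
      have "real (v\<^sup>2) \<le> real (s + 1)" using that by (simp only: of_nat_le_iff)
      then have "real v \<le> sqrt (real s + 1)" by (intro real_le_rsqrt) (simp add: add.commute)
      then have "int v \<le> \<lfloor>sqrt (real s + 1)\<rfloor>" by (simp add: le_floor_iff)
      then show ?thesis using n k by linarith
    qed
    have "k > 0" using assms k by simp
    from gen_frobenius_triangle_even[OF this c s small]
    have frob: "gen_frobenius [triangle n, triangle (n + 1), triangle (n + 2)] s
       = int (k + 1) * int (2 * k + 1) * (int k * (int r + 3) + 3 * int c) - 1"
      by (simp add: k)
    show "real_of_int (gen_frobenius [triangle n, triangle (n + 1), triangle (n + 2)] s) =
        (real n + 1) * (real n + 2) / 4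
          * (of_int (q_coeff s) * real n + 6 * of_int (c_coeff s)) - 1"
      unfolding frob coeffs by (simp add: k field_simps)
  next
    assume "odd n" and n: "int n > 6 * \<lfloor>(sqrt (4 * real s + 5) - 1) / 2\<rfloor> - 3"
    then obtain k where k: "n = 2 * k + 1" by (auto elim: oddE)
    have small: "3 * w \<le> k + 1" if "w * (w + 1) \<le> s + 1" for w
    proof -
      have "real (w * (w + 1)) \<le> real (s + 1)" using that by (simp only: of_nat_le_iff)
      \<comment> \<open>Multiplying by 4 and adding 1 completes the square, whence the constant
        5.\<close>
      then have "(2 * real w + 1)\<^sup>2 \<le> 4 * real s + 5"
        by (simp add: power2_eq_square algebra_simps)
      then have "2 * real w + 1 \<le> sqrt (4 * real s + 5)" by (rule real_le_rsqrt)
      then have "int w \<le> \<lfloor>(sqrt (4 * real s + 5) - 1) / 2\<rfloor>" by (simp add: le_floor_iff)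
      then show ?thesis using n k by linarith
    qed
    have frob: "gen_frobenius [triangle n, triangle (n + 1), triangle (n + 2)] s
       = int (k + 1) * int (2 * k + 3) * ((int k + 2) * int r - 3 * int (r div 2) + 3 * int c + 3 * int k) - 1"
      using gen_frobenius_triangle_odd[OF c s small] by (simp add: k numeral_3_eq_3)
    \<comment> \<open>Rounding in \<open>r div 2\<close> depends on the parity of \<open>r\<close>;
      this produces the term \<open>- 3 * delta s\<close>.\<close>
    have half: "2 * real (r div 2) = real r - 1 + of_int (delta s)"
      unfolding coeffs by (auto elim!: evenE oddE)
    show "real_of_int (gen_frobenius [triangle n, triangle (n + 1), triangle (n + 2)] s) =
        (real n + 1) * (real n + 2) / 4
          * (of_int (q_coeff s) * real n + 6 * of_int (c_coeff s) - 3 * of_int (delta s)) - 1"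
      unfolding frob coeffs(1,2) using half by (simp add: k) algebra
  qed
qed

end
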